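(* Let $\tau$ be a given mean trajectory and consider the convex covariance subproblem $$\min_{S_k(i),\,L_k(i),\,Y_k(i)}\ J(\Xi)=\sum_{k=0}^{T-1}\sum_{i\in\mathcal S}\mathrm{Tr}\big(S_k(i)Q_k+Y_k(i)R_k\big)$$ subject to, for all $k\in\{0,\dots,T-1\}$ and $i,j\in\mathcal S$, $$S_{k+1}(j)=\sum_{i\in\mathcal S}p_{ij}\Big\{A_k(i)S_k(i)A_k^\top(i)+A_k(i)L_k^\top(i)B_k^\top(i)+B_k(i)L_k(i)A_k^\top(i)+B_k(i)Y_k(i)B_k^\top(i)+\rho_k(i)m_k(i)m_k^\top(i)+\rho_k(i)G_k(i)G_k^\top(i)\Big\}-\rho_{k+1}(j)\overline x_{k+1}(j)\overline x_{k+1}^\top(j),$$ $$\begin{bmatrix}Y_k(i)&L_k(i)\\ L_k^\top(i)&S_k(i)\end{bmatrix}\succeq 0,\qquad S_0(i)=\rho_0(i)\Sigma_0,\qquad \Sigma_T\preceq\Sigma_f,$$ where $m_k(i)=A_k(i)\overline x_k(i)+B_k(i)\overline u_k(i)+c_k(i)$ and $\Sigma_T=\sum_{i\in\mathcal S}\big(S_T(i)+\rho_T(i)(\overline x_T(i)-\mu_T)(\overline x_T(i)-\mu_T)^\top\big)$. Assume that (1) $\rho_k(i)>0$ for all $k\in\{0,\dots,T\}$, $i\in\mathcal S$; (2) $S_k(i)\succ0$ for all $k\in\{0,\dots,T\}$, $i\in\mathcal S$; (3) Slater's condition holds for this problem, i.e. there exists a strictly feasible point (all equality constraints hold, and the matrix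 inequalities hold strictly, with $\succ$ and $\prec$). Then every optimal solution of this problem satisfies $$Y_k(i)=L_k(i)S_k^{-1}(i)L_k^\top(i)\qquad\text{for all }k\in\{0,\dots,T-1\},\ i\in\mathcal S,$$ i.e. the relaxation of the equality $Y_k(i)=L_k(i)S_k^{-1}(i)L_k^\top(i)$ to $Y_k(i)\succeq L_k(i)S_k^{-1}(i)L_k^\top(i)$ is lossless.
   Context: Setting. $T\ge1$ is a finite horizon, $\mathcal S=\{1,\dots,N\}$ is the set of modes, and $\mathcal P=(p_{ij})_{i,j\in\mathcal S}$ is a (row-)stochastic transition matrix. $\rho_0$ is an initial probability row vector on $\mathcal S$ and $\rho_k=\rho_0\mathcal P^k$, with entries $\rho_k(i)$. For each $k$ and $i$: $A_k(i)\in\mathbb R^{n_x\times n_x}$ is invertible, $B_k(i)\in\mathbb R^{n_x\times n_u}$, $c_k(i)\in\mathbb R^{n_x}$, $G_k(i)\in\mathbb R^{n_x\times n_w}$. The cost matrices are symmetric with $Q_k\succeq0$ and $R_k\succ0$. $\Sigma_0,\Sigma_f$ are given symmetric $n_x\times n_x$ matrices (initial covariance and terminal covariance bound). These data come from the Markov jump linear system $x_{k+1}=A_k(r_k)x_k+B_k(r_k)u_k+c_k(r_k)+G_k(r_k)w_k$, where $r_k$ is the Markov chain and $w_k$ is zero-mean white noise with identity covariance. Mean trajectory $\tau$: vectors $\mu_k,\overline x_k(i)\in\mathbb R^{n_x}$ ($0\le k\le T$) and $\overline u_k(i)\in\mathbb R^{n_u}$ ($0\le k\le T-1$), $i\in\mathcal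 S$, such that with $q_k(i)=\rho_k(i)\overline x_k(i)$ one has $\mu_k=\sum_{i}q_k(i)$ and $q_{k+1}(j)=\sum_{i}p_{ij}\big(A_k(i)q_k(i)+\rho_k(i)(B_k(i)\overline u_k(i)+c_k(i))\big)$. The mean trajectory is fixed data in the problem. Decision variables: symmetric $S_k(i)\in\mathbb R^{n_x\times n_x}$ ($0\le k\le T$), $L_k(i)\in\mathbb R^{n_u\times n_x}$ and symmetric $Y_k(i)\in\mathbb R^{n_u\times n_u}$ ($0\le k\le T-1$). Assumption (2) is a standing assumption that the matrices $S_k(i)$ of the solutions under consideration are positive definite, so that $S_k^{-1}(i)$ makes sense. $\succeq,\preceq$ (resp. $\succ,\prec$) denote the positive semidefinite (resp. definite) order on symmetric matrices. *)

theory Defs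
  imports "HOL-Analysis.Analysis"
begin

definition psd :: "real^'n^'n \<Rightarrow> bool" where
  "psd M \<longleftrightarrow> transpose M = M \<and> (\<forall>x. 0 \<le> x \<bullet> (M *v x))"

definition pd :: "real^'n^'n \<Rightarrow> bool" where
  "pd M \<longleftrightarrow> transpose M = M \<and> (\<forall>x. x \<noteq> 0 \<longrightarrow> 0 < x \<bullet> (M *v x))"

definition outer :: "real^'n \<Rightarrow> real^'n^'n" where
  "outer x = (columnvector x :: real^1^'n) ** rowvector x"

definition block_matrix ::
  "real^'a^'a \<Rightarrow> real^'b^'a \<Rightarrow> real^'a^'b \<Rightarrow> real^'b^'b \<Rightarrow> real^('a + 'b)^('a + 'b)" where
  "block_matrix M11 M12 M21 M22 =
     (\<chi> r s. case r of
        Inl a \<Rightarrow> (case s of Inl a' \<Rightarrow> M11 $ a $ a' | Inr b' \<Rightarrow> M12 $ a $ b')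
      | Inr b \<Rightarrow> (case s of Inl a' \<Rightarrow> M21 $ b $ a' | Inr b' \<Rightarrow> M22 $ b $ b'))"

definition matrix_power :: "real^'n^'n \<Rightarrow> nat \<Rightarrow> real^'n^'n" where
  "matrix_power M k = (((**) M) ^^ k) (mat 1)"

text \<open>The finite index types \<open>'m\<close>, \<open>'x\<close>, \<open>'u\<close>, \<open>'w\<close> stand for the set of modes and for the
  coordinates of the state, the input and the noise. Sequences in time are functions on
  \<^typ>\<open>nat\<close>; only their values up to the horizon are ever constrained or used.\<close>

record ('m, 'x, 'u, 'w) mjls =
  horizon :: nat
  trans :: "real^'m^'m"
  init :: "real^'m"
  Amat :: "nat \<Rightarrow> 'm \<Rightarrow> real^'x^'x"
  Bmat :: "nat \<Rightarrow> 'm \<Rightarrow> real^'u^'x"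
  cvec :: "nat \<Rightarrow> 'm \<Rightarrow> real^'x"
  Gmat :: "nat \<Rightarrow> 'm \<Rightarrow> real^'w^'x"
  Qcost :: "nat \<Rightarrow> real^'x^'x"
  Rcost :: "nat \<Rightarrow> real^'u^'u"
  Sigma0 :: "real^'x^'x"
  Sigmaf :: "real^'x^'x"

definition mjls_data ::
  "('m::finite, 'x::finite, 'u::finite, 'w::finite) mjls \<Rightarrow> bool" where
  "mjls_data D \<longleftrightarrow>
     1 \<le> horizon D \<and>
     (\<forall>i j. 0 \<le> trans D $ i $ j) \<and> (\<forall>i. (\<Sum>j\<in>UNIV. trans D $ i $ j) = 1) \<and>
     (\<forall>i. 0 \<le> init D $ i) \<and> (\<Sum>i\<in>UNIV. init D $ i) = 1 \<and>
     (\<forall>k<horizon D. \<forall>i. invertible (Amat D k i)) \<and>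
     (\<forall>k<horizon D. psd (Qcost D k) \<and> pd (Rcost D k)) \<and>
     transpose (Sigma0 D) = Sigma0 D \<and> transpose (Sigmaf D) = Sigmaf D"

definition rho ::
  "('m::finite, 'x::finite, 'u::finite, 'w::finite) mjls \<Rightarrow> nat \<Rightarrow> 'm \<Rightarrow> real" where
  "rho D k i = (init D v* matrix_power (trans D) k) $ i"

record ('m, 'x, 'u) trajectory =
  mean :: "nat \<Rightarrow> real^'x"
  xbar :: "nat \<Rightarrow> 'm \<Rightarrow> real^'x"
  ubar :: "nat \<Rightarrow> 'm \<Rightarrow> real^'u"

definition mean_trajectory ::
  "('m::finite, 'x::finite, 'u::finite, 'w::finite) mjls \<Rightarrow> ('m, 'x, 'u) trajectory \<Rightarrow> bool" where
  "mean_trajectory D \<tau> \<longleftrightarrow>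
     (let q = (\<lambda>k i. rho D k i *\<^sub>R xbar \<tau> k i) in
       (\<forall>k\<le>horizon D. mean \<tau> k = (\<Sum>i\<in>UNIV. q k i)) \<and>
       (\<forall>k<horizon D. \<forall>j. q (Suc k) j =
          (\<Sum>i\<in>UNIV. trans D $ i $ j *\<^sub>R
             (Amat D k i *v q k i + rho D k i *\<^sub>R (Bmat D k i *v ubar \<tau> k i + cvec D k i)))))"

definition mvec ::
  "('m::finite, 'x::finite, 'u::finite, 'w::finite) mjls \<Rightarrow> ('m, 'x, 'u) trajectory \<Rightarrow>
   nat \<Rightarrow> 'm \<Rightarrow> real^'x" where
  "mvec D \<tau> k i = Amat D k i *v xbar \<tau> k i + Bmat D k i *v ubar \<tau> k i + cvec D k i"

record ('m, 'x, 'u) decision =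
  Svar :: "nat \<Rightarrow> 'm \<Rightarrow> real^'x^'x"
  Lvar :: "nat \<Rightarrow> 'm \<Rightarrow> real^'x^'u"
  Yvar :: "nat \<Rightarrow> 'm \<Rightarrow> real^'u^'u"

text \<open>Since \<open>S Q\<close> and \<open>Y R\<close> have different sizes in general, \<open>Tr (S Q + Y R)\<close> is read as the sum of
  the two traces.\<close>

definition cost ::
  "('m::finite, 'x::finite, 'u::finite, 'w::finite) mjls \<Rightarrow> ('m, 'x, 'u) decision \<Rightarrow> real" where
  "cost D \<Xi> = (\<Sum>k<horizon D. \<Sum>i\<in>UNIV.
     trace (Svar \<Xi> k i ** Qcost D k) + trace (Yvar \<Xi> k i ** Rcost D k))"

definition terminal_covariance ::
  "('m::finite, 'x::finite, 'u::finite, 'w::finite) mjls \<Rightarrow> ('m, 'x, 'u) trajectory \<Rightarrow>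
   ('m, 'x, 'u) decision \<Rightarrow> real^'x^'x" where
  "terminal_covariance D \<tau> \<Xi> = (let T = horizon D in
     \<Sum>i\<in>UNIV. Svar \<Xi> T i + rho D T i *\<^sub>R outer (xbar \<tau> T i - mean \<tau> T))"

definition lmi_block :: "('m, 'x::finite, 'u::finite) decision \<Rightarrow> nat \<Rightarrow> 'm \<Rightarrow> real^('u + 'x)^('u + 'x)"
  where "lmi_block \<Xi> k i =
     block_matrix (Yvar \<Xi> k i) (Lvar \<Xi> k i) (transpose (Lvar \<Xi> k i)) (Svar \<Xi> k i)"

text \<open>The decision variables \<open>S\<close> and \<open>Y\<close> range over symmetric matrices; this is encoded here as linear
  constraints rather than in the type.\<close>

definition equality_constraints ::
  "('m::finite, 'x::finite, 'u::finite, 'w::finite) mjls \<Rightarrow> ('m, 'x, 'u) trajectory \<Rightarrow>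
   ('m, 'x, 'u) decision \<Rightarrow> bool" where
  "equality_constraints D \<tau> \<Xi> \<longleftrightarrow>
     (\<forall>k\<le>horizon D. \<forall>i. transpose (Svar \<Xi> k i) = Svar \<Xi> k i) \<and>
     (\<forall>k<horizon D. \<forall>i. transpose (Yvar \<Xi> k i) = Yvar \<Xi> k i) \<and>
     (\<forall>k<horizon D. \<forall>j. Svar \<Xi> (Suc k) j =
        (\<Sum>i\<in>UNIV. trans D $ i $ j *\<^sub>R
           (Amat D k i ** Svar \<Xi> k i ** transpose (Amat D k i)
            + Amat D k i ** transpose (Lvar \<Xi> k i) ** transpose (Bmat D k i)
            + Bmat D k i ** Lvar \<Xi> k i ** transpose (Amat D k i)
            + Bmat D k i ** Yvar \<Xi> k i ** transpose (Bmat D k i)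
            + rho D k i *\<^sub>R outer (mvec D \<tau> k i)
            + rho D k i *\<^sub>R (Gmat D k i ** transpose (Gmat D k i))))
        - rho D (Suc k) j *\<^sub>R outer (xbar \<tau> (Suc k) j)) \<and>
     (\<forall>i. Svar \<Xi> 0 i = rho D 0 i *\<^sub>R Sigma0 D)"

definition feasible ::
  "('m::finite, 'x::finite, 'u::finite, 'w::finite) mjls \<Rightarrow> ('m, 'x, 'u) trajectory \<Rightarrow>
   ('m, 'x, 'u) decision \<Rightarrow> bool" where
  "feasible D \<tau> \<Xi> \<longleftrightarrow>
     equality_constraints D \<tau> \<Xi> \<and>
     (\<forall>k<horizon D. \<forall>i. psd (lmi_block \<Xi> k i)) \<and>
     psd (Sigmaf D - terminal_covariance D \<tau> \<Xi>)"

definition strictly_feasible ::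
  "('m::finite, 'x::finite, 'u::finite, 'w::finite) mjls \<Rightarrow> ('m, 'x, 'u) trajectory \<Rightarrow>
   ('m, 'x, 'u) decision \<Rightarrow> bool" where
  "strictly_feasible D \<tau> \<Xi> \<longleftrightarrow>
     equality_constraints D \<tau> \<Xi> \<and>
     (\<forall>k<horizon D. \<forall>i. pd (lmi_block \<Xi> k i)) \<and>
     pd (Sigmaf D - terminal_covariance D \<tau> \<Xi>)"

definition optimal ::
  "('m::finite, 'x::finite, 'u::finite, 'w::finite) mjls \<Rightarrow> ('m, 'x, 'u) trajectory \<Rightarrow>
   ('m, 'x, 'u) decision \<Rightarrow> bool" where
  "optimal D \<tau> \<Xi> \<longleftrightarrow> feasible D \<tau> \<Xi> \<and> (\<forall>\<Xi>'. feasible D \<tau> \<Xi>' \<longrightarrow> cost D \<Xi> \<le> cost D \<Xi>')"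

end

theory Submission
  imports Defs
begin

text \<open>
  An optimal solution can be compared directly with a cheaper one that uses the same feedback
  gains. Put \<open>K = L S\<inverse>\<close> for the given solution. By the Schur complement, the LMI says
  \<open>Y \<succeq> K S K\<^sup>T\<close>, and with \<open>F = A + B K\<close> the covariance recursion reads
  \<open>S\<^sub>k\<^sub>+\<^sub>1(j) = (\<Sum>i. p\<^sub>i\<^sub>j (F S\<^sub>k(i) F\<^sup>T + B (Y - K S K\<^sup>T) B\<^sup>T)) + W\<^sub>k(j)\<close>.
  Here \<open>W\<close> (called \<open>disturbance\<close>) collects the terms in \<open>m m\<^sup>T\<close>, \<open>G G\<^sup>T\<close> and
  \<open>- xbar xbar\<^sup>T\<close>, which do not involve the decision variables.

  Run this recursion again from the same initial covariance and with the same gains, but with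
  \<open>Y - K S K\<^sup>T\<close> replaced by \<open>0\<close>. The resulting \<open>S'\<close> satisfies \<open>0 \<preceq> S' \<preceq> S\<close> by induction on time:
  the difference \<open>S - S'\<close> is propagated by congruences and fed with positive semidefinite terms
  only, and \<open>S'\<close> stays positive semidefinite because \<open>W \<succeq> 0\<close>. The latter is where the mean
  trajectory enters: \<open>\<rho>\<^sub>k\<^sub>+\<^sub>1(j)\<close> and \<open>\<rho>\<^sub>k\<^sub>+\<^sub>1(j) xbar\<^sub>k\<^sub>+\<^sub>1(j)\<close> are the total mass and the weighted sum of the
  \<open>m\<^sub>k(i)\<close> with weights \<open>p\<^sub>i\<^sub>j \<rho>\<^sub>k(i)\<close>, so the outer-product part of \<open>W\<close> is a weighted covariance matrix.

  Hence \<open>S'\<close>, \<open>L' = K S'\<close>, \<open>Y' = K S' K\<^sup>T\<close> is feasible and \<open>Y' \<preceq> K S K\<^sup>T \<preceq> Y\<close>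
  (\<open>feedback_decision_dominated\<close>). Its cost is at most that of the given solution, so by optimality
  the costs agree. Since \<open>R \<succ> 0\<close>, this forces \<open>Y = Y'\<close> (\<open>cost_le_imp_Yvar_eq\<close>), and the sandwich
  collapses to \<open>Y = K S K\<^sup>T = L S\<inverse> L\<^sup>T\<close>.
\<close>

section \<open>Matrix algebra\<close>

lemma outer_nth: "outer x $ a $ b = x $ a * x $ b"
  by (simp add: outer_def matrix_matrix_mult_def columnvector_def rowvector_def)

lemma outer_mult_vec: "outer v *v x = (v \<bullet> x) *\<^sub>R v"
  by (simp add: vec_eq_iff matrix_vector_mult_def outer_nth inner_vec_def sum_distrib_left
      mult_ac)

lemma matrix_diff_ldistrib: "A ** (B - C) = A ** B - A ** (C :: real^'n^'m)"
  by (simp add: vec_eq_iff matrix_matrix_mult_def right_diff_distrib sum_subtractf)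

lemma matrix_diff_rdistrib: "(A - B) ** C = A ** C - B ** (C :: real^'n^'m)"
  by (simp add: vec_eq_iff matrix_matrix_mult_def left_diff_distrib sum_subtractf)

lemma matrix_add_rdistrib: "(A + B) ** C = A ** C + B ** (C :: real^'n^'m)"
  by (simp add: vec_eq_iff matrix_matrix_mult_def distrib_right sum.distrib)

lemma transpose_add: "transpose (A + B) = transpose A + transpose (B :: real^'n^'m)"
  by (simp add: vec_eq_iff transpose_def)

lemma transpose_diff: "transpose (A - B) = transpose A - transpose (B :: real^'n^'m)"
  by (simp add: vec_eq_iff transpose_def)

lemma matrix_vector_mult_minus: "A *v (- x) = - (A *v (x :: real^'n))"
  by (simp add: vec_eq_iff matrix_vector_mult_def sum_negf)

section \<open>The cone of positive semidefinite matrices\<close>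

lemma psd_symmetric: "psd M \<Longrightarrow> transpose M = M"
  by (simp add: psd_def)

lemma pd_symmetric: "pd M \<Longrightarrow> transpose M = M"
  by (simp add: pd_def)

lemma pd_imp_psd: "pd M \<Longrightarrow> psd M"
  unfolding pd_def psd_def by (metis inner_zero_left order.order_iff_strict)

lemma psd_0: "psd 0"
  by (simp add: psd_def transpose_def vec_eq_iff)

lemma psd_add: "psd M \<Longrightarrow> psd N \<Longrightarrow> psd (M + N)"
  by (simp add: psd_def transpose_add matrix_vector_mult_add_rdistrib inner_add_right)

lemma psd_scaleR: "0 \<le> c \<Longrightarrow> psd M \<Longrightarrow> psd (c *\<^sub>R M)"
  by (simp add: psd_def transpose_scalar flip: scaleR_matrix_vector_assoc)

lemma psd_sum: "(\<And>i. i \<in> I \<Longrightarrow> psd (f i)) \<Longrightarrow> psd (\<Sum>i\<in>I. f i)"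
  by (induction I rule: infinite_finite_induct) (simp_all add: psd_0 psd_add)

lemma psd_congruence:
  fixes P :: "real^'n^'m"
  assumes "psd M"
  shows "psd (P ** M ** transpose P)"
proof -
  have "x \<bullet> (P ** M ** transpose P *v x) = (x v* P) \<bullet> (M *v (x v* P))" for x
    by (simp add: dot_lmul_matrix flip: matrix_vector_mul_assoc)
  moreover have "transpose (P ** M ** transpose P) = P ** M ** transpose P"
    using assms by (simp add: matrix_transpose_mul psd_def matrix_mul_assoc)
  ultimately show ?thesis
    using assms by (simp add: psd_def)
qed

lemma psd_gram: "psd (G ** transpose (G :: real^'n^'m))"
proof -
  have "psd (mat 1 :: real^'n^'n)"
    by (simp add: psd_def)
  then show ?thesis
    using psd_congruence[of "mat 1" G] by simp
qed

lemma psd_outer: "psd (outer v)"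
  by (simp add: psd_def outer_mult_vec vec_eq_iff transpose_def outer_nth mult.commute inner_commute)

lemma psd_diff_trans: "psd (A - B) \<Longrightarrow> psd (B - C) \<Longrightarrow> psd (A - C)"
  using psd_add[of "A - B" "B - C"] by simp

lemma symmetric_inner:
  assumes "transpose M = M"
  shows "x \<bullet> (M *v y) = y \<bullet> (M *v (x :: real^'n))"
  by (metis assms dot_lmul_matrix inner_commute transpose_matrix_vector)

lemma axis_inner_mult_axis: "axis i 1 \<bullet> (M *v axis j 1) = (M :: real^'n^'n) $ i $ j"
  by (simp add: inner_axis' matrix_vector_mult_basis column_def)

text \<open>The form \<open>x \<bullet> M y\<close> may be degenerate, so the usual discriminant argument is split according to
  whether \<open>x\<close> is isotropic. The inequality controls the entries of \<open>M\<close> by its diagonal.\<close>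
lemma psd_cauchy_schwarz:
  assumes "psd M"
  shows "(x \<bullet> (M *v y))\<^sup>2 \<le> (x \<bullet> (M *v x)) * (y \<bullet> (M *v y))"
proof -
  define a b c where "a = x \<bullet> (M *v x)" and "b = x \<bullet> (M *v y)" and "c = y \<bullet> (M *v y)"
  have sym: "y \<bullet> (M *v x) = b"
    using assms symmetric_inner psd_symmetric unfolding b_def by metis
  have q: "0 \<le> s\<^sup>2 * a + 2 * s * t * b + t\<^sup>2 * c" for s t
  proof -
    have "(s *\<^sub>R x + t *\<^sub>R y) \<bullet> (M *v (s *\<^sub>R x + t *\<^sub>R y)) = s\<^sup>2 * a + 2 * s * t * b + t\<^sup>2 * c"
      by (simp add: matrix_vector_right_distrib matrix_vector_mult_scaleR inner_add_left
          inner_add_right sym a_def[symmetric] b_def[symmetric] c_def[symmetric]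
          power2_eq_square algebra_simps)
    then show ?thesis
      using assms unfolding psd_def by metis
  qed
  have a0: "0 \<le> a" and c0: "0 \<le> c"
    using assms by (auto simp: psd_def a_def c_def)
  show ?thesis
  proof (cases "a = 0")
    case True
    have "b = 0"
    proof (rule ccontr)
      assume "b \<noteq> 0"
      \<comment> \<open>With \<open>a = 0\<close> the form is affine in \<open>s\<close>; this \<open>s\<close> gives it the value \<open>- 1\<close>.\<close>
      with q[of "- (c + 1) / (2 * b)" 1] True show False
        by (simp add: field_simps)
    qed
    then show ?thesis
      using True by (simp add: a_def b_def)
  next
    case False
    have "0 \<le> a * (a * c - b\<^sup>2)"
      using q[of b "- a"] by (simp add: power2_eq_square algebra_simps)
    then have "b\<^sup>2 \<le> a * c"
      using False a0 by (simp add: zero_le_mult_iff)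
    then show ?thesis
      by (simp add: a_def b_def c_def)
  qed
qed

lemma psd_antisym:
  assumes "psd M" and "psd (- M)"
  shows "M = 0"
proof -
  have neg: "(- M) *v x = - (M *v x)" for x
    by (simp add: vec_eq_iff matrix_vector_mult_def sum_negf)
  have "x \<bullet> (M *v x) = 0" for x
    using assms unfolding psd_def neg inner_minus_right by (smt (verit))
  then have "(x \<bullet> (M *v y))\<^sup>2 \<le> 0" for x y
    using psd_cauchy_schwarz[OF assms(1), of x y] by simp
  then have "axis i 1 \<bullet> (M *v axis j 1) = 0" for i j
    by simp
  then show ?thesis
    by (simp add: axis_inner_mult_axis vec_eq_iff)
qed

text \<open>This induction principle takes the place of a spectral decomposition. If some diagonal entry
  \<open>d = M\<^sub>i\<^sub>i\<close> is nonzero, one elimination step subtracts the outer product of the \<open>i\<close>-th column divided by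
  \<open>sqrt d\<close>: by Cauchy-Schwarz the remainder is positive semidefinite, its \<open>i\<close>-th diagonal entry
  vanishes, and zero diagonal entries stay zero. When the whole diagonal is zero, so is \<open>M\<close>.\<close>
lemma psd_outer_induct [consumes 1, case_names zero add_outer]:
  assumes "psd M"
    and zero: "P 0"
    and add: "\<And>N v. psd N \<Longrightarrow> P N \<Longrightarrow> P (N + outer v)"
  shows "P M"
  using \<open>psd M\<close>
proof (induction "card {i. M $ i $ i \<noteq> 0}" arbitrary: M rule: less_induct)
  case less
  note M = less.prems
  have cs: "(M $ i $ j)\<^sup>2 \<le> M $ i $ i * M $ j $ j" for i j
    using psd_cauchy_schwarz[OF M, of "axis i 1" "axis j 1"] by (simp only: axis_inner_mult_axis)
  show ?case
  proof (cases "\<exists>i. M $ i $ i \<noteq> 0")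
    case False
    with cs have "M $ i $ j = 0" for i j
      by (metis mult_zero_left power2_less_eq_zero_iff)
    then have "M = 0"
      by (simp add: vec_eq_iff)
    then show ?thesis
      using zero by simp
  next
    case True
    then obtain i where i: "M $ i $ i \<noteq> 0"
      by blast
    define e where "e = (axis i 1 :: real^'a)"
    define d where "d = M $ i $ i"
    have d: "d = e \<bullet> (M *v e)"
      by (simp add: d_def e_def axis_inner_mult_axis)
    then have d0: "0 < d"
      using M i unfolding psd_def d_def by (metis order.order_iff_strict)
    define v where "v = (1 / sqrt d) *\<^sub>R (M *v e)"
    define N where "N = M - outer v"
    have vv: "(v \<bullet> x)\<^sup>2 = (e \<bullet> (M *v x))\<^sup>2 / d" for x
    proof -
      have "v \<bullet> x = (e \<bullet> (M *v x)) / sqrt d"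
        using symmetric_inner[OF psd_symmetric[OF M], of x e]
        by (simp add: v_def inner_commute)
      then show ?thesis
        using d0 by (simp add: power_divide)
    qed
    have "psd N"
    proof -
      have "0 \<le> x \<bullet> (N *v x)" for x
      proof -
        have "x \<bullet> (N *v x) = x \<bullet> (M *v x) - (v \<bullet> x)\<^sup>2"
          by (simp add: N_def matrix_vector_mult_diff_rdistrib outer_mult_vec inner_diff_right
              power2_eq_square inner_commute)
        moreover have "(e \<bullet> (M *v x))\<^sup>2 / d \<le> x \<bullet> (M *v x)"
          using psd_cauchy_schwarz[OF M, of e x] d0 d by (simp add: divide_le_eq mult.commute)
        ultimately show ?thesis
          by (simp add: vv)
      qed
      then show ?thesis
        using psd_symmetric[OF M] psd_symmetric[OF psd_outer, of v]
        by (simp add: psd_def N_def transpose_diff)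
    qed
    have diag: "N $ j $ j = M $ j $ j - (M $ i $ j)\<^sup>2 / d" for j
      using vv[of "axis j 1"]
      by (simp add: N_def outer_nth e_def axis_inner_mult_axis inner_axis power2_eq_square)
    have "{j. N $ j $ j \<noteq> 0} \<subset> {j. M $ j $ j \<noteq> 0}"
    proof -
      have "N $ i $ i = 0"
        using d0 by (simp add: diag d_def power2_eq_square)
      moreover have "N $ j $ j = 0" if "M $ j $ j = 0" for j
      proof -
        have "(M $ i $ j)\<^sup>2 \<le> 0"
          using cs[of i j] that by simp
        then show ?thesis
          using that by (simp add: diag)
      qed
      ultimately show ?thesis
        using i by blast
    qed
    then have "P N"
      using \<open>psd N\<close> by (intro less.hyps psubset_card_mono) simp_all
    then have "P (N + outer v)"
      using \<open>psd N\<close> add by blast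
    then show ?thesis
      by (simp add: N_def)
  qed
qed

lemma trace_outer_mult: "trace (outer v ** R) = v \<bullet> (R *v v)"
proof -
  have "trace (outer v ** R) = trace (R ** outer v)"
    by (rule trace_mul_sym)
  also have "\<dots> = v \<bullet> (R *v v)"
    by (simp add: trace_def matrix_matrix_mult_def outer_nth inner_vec_def matrix_vector_mult_def
        sum_distrib_left sum_distrib_right mult_ac)
  finally show ?thesis .
qed

lemma trace_psd_mult_nonneg:
  assumes "psd M" and "psd R"
  shows "0 \<le> trace (M ** R)"
  using assms(1)
proof (induction rule: psd_outer_induct)
  case zero
  then show ?case by (simp add: trace_def matrix_matrix_mult_def)
next
  case (add_outer N v)
  then show ?case
    using assms(2) by (simp add: matrix_add_rdistrib trace_add trace_outer_mult psd_def)
qed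

text \<open>Each outer product \<open>v v\<^sup>T\<close> in \<open>M\<close> contributes \<open>v \<bullet> R v\<close> to the trace, which is positive unless
  \<open>v = 0\<close>.\<close>
lemma trace_psd_mult_pd_eq_0_imp:
  assumes "psd M" and "pd R" and "trace (M ** R) = 0"
  shows "M = 0"
  using assms(1,3)
proof (induction rule: psd_outer_induct)
  case (add_outer N v)
  have "0 \<le> trace (N ** R)"
    using add_outer.hyps pd_imp_psd[OF assms(2)] by (rule trace_psd_mult_nonneg)
  moreover have "0 \<le> v \<bullet> (R *v v)"
    using pd_imp_psd[OF assms(2)] by (simp add: psd_def)
  ultimately have "trace (N ** R) = 0" and "v \<bullet> (R *v v) = 0"
    using add_outer.prems by (simp_all add: matrix_add_rdistrib trace_add trace_outer_mult)
  then have "N = 0" and "v = 0"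
    using add_outer.IH assms(2) unfolding pd_def by (auto)
  then show ?case
    by (simp add: vec_eq_iff outer_nth)
qed simp

section \<open>Block matrices and Schur complements\<close>

lemma sum_UNIV_sum: "(\<Sum>r\<in>UNIV. f r) = (\<Sum>a\<in>UNIV. f (Inl a)) + (\<Sum>b\<in>UNIV. f (Inr b))"
  for f :: "'a::finite + 'b::finite \<Rightarrow> 'c::comm_monoid_add"
  using sum.Plus[of "UNIV :: 'a set" "UNIV :: 'b set" f] by (simp add: comp_def)

lemma transpose_block_matrix:
  "transpose (block_matrix A B C D) =
    block_matrix (transpose A) (transpose C) (transpose B) (transpose D)"
  by (simp add: vec_eq_iff transpose_def block_matrix_def split: sum.split)

lemma block_quadratic_form:
  fixes L :: "real^'x^'u"
  defines "up x \<equiv> (\<chi> a. x $ Inl a)" and "lo x \<equiv> (\<chi> b. x $ Inr b)"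
  shows "x \<bullet> (block_matrix Y L M S *v x) =
    up x \<bullet> (Y *v up x) + up x \<bullet> (L *v lo x) + lo x \<bullet> (M *v up x) + lo x \<bullet> (S *v lo x)"
  by (simp add: inner_vec_def matrix_vector_mult_def block_matrix_def up_def lo_def
      sum_UNIV_sum distrib_left sum.distrib)

lemma pd_imp_invertible:
  assumes "pd S"
  shows "invertible S"
proof -
  have "x = 0" if "S *v x = 0" for x
    using assms that unfolding pd_def by (metis inner_zero_right less_irrefl)
  then show ?thesis
    using invertible_left_inverse matrix_left_invertible_ker by blast
qed

lemma matrix_inv_inverse:
  assumes "invertible (S :: real^'n^'n)"
  shows "S ** matrix_inv S = mat 1" and "matrix_inv S ** S = mat 1"
  using assms someI_ex[of "\<lambda>S'. S ** S' = mat 1 \<and> S' ** S = mat 1"]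
  unfolding invertible_def matrix_inv_def by blast+

lemma matrix_inv_symmetric:
  assumes "invertible S" and "transpose S = (S :: real^'n^'n)"
  shows "transpose (matrix_inv S) = matrix_inv S"
proof -
  have "transpose (matrix_inv S) = transpose (matrix_inv S) ** (S ** matrix_inv S)"
    using matrix_inv_inverse(1)[OF assms(1)] by simp
  also have "\<dots> = transpose (S ** matrix_inv S) ** matrix_inv S"
    by (simp add: matrix_transpose_mul matrix_mul_assoc assms(2))
  also have "\<dots> = matrix_inv S"
    using matrix_inv_inverse(1)[OF assms(1)] by simp
  finally show ?thesis .
qed

text \<open>Writing the off-diagonal block as \<open>K S\<close> avoids any inverse: the block quadratic form at
  \<open>(x, - K\<^sup>T x)\<close> is the form of the Schur complement at \<open>x\<close>.\<close>
lemma psd_block_imp_schur: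
  fixes K :: "real^'x^'u"
  assumes psd: "psd (block_matrix Y (K ** S) (transpose (K ** S)) S)"
    and "transpose S = S" and "transpose Y = Y"
  shows "psd (Y - K ** S ** transpose K)"
proof -
  have "0 \<le> x \<bullet> ((Y - K ** S ** transpose K) *v x)" for x
  proof -
    define y where "y = - (x v* K)"
    define z where "z = (\<chi> r. case r of Inl a \<Rightarrow> x $ a | Inr b \<Rightarrow> y $ b)"
    have z: "(\<chi> a. z $ Inl a) = x" "(\<chi> b. z $ Inr b) = y"
      by (simp_all add: z_def)
    have "z \<bullet> (block_matrix Y (K ** S) (transpose (K ** S)) S *v z)
        = x \<bullet> (Y *v x) + x \<bullet> (K ** S *v y) + y \<bullet> (transpose (K ** S) *v x) + y \<bullet> (S *v y)"
      unfolding block_quadratic_form z ..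
    also have "y \<bullet> (transpose (K ** S) *v x) = x \<bullet> (K ** S *v y)"
      unfolding transpose_matrix_vector by (metis inner_commute dot_lmul_matrix)
    also have "x \<bullet> (K ** S *v y) = - (y \<bullet> (S *v y))"
      by (simp add: y_def dot_lmul_matrix matrix_vector_mult_minus flip: matrix_vector_mul_assoc)
    also have "y \<bullet> (S *v y) = x \<bullet> (K ** S ** transpose K *v x)"
      by (simp add: y_def dot_lmul_matrix matrix_vector_mult_minus flip: matrix_vector_mul_assoc)
    finally have "z \<bullet> (block_matrix Y (K ** S) (transpose (K ** S)) S *v z) =
        x \<bullet> ((Y - K ** S ** transpose K) *v x)"
      by (simp add: matrix_vector_mult_diff_rdistrib inner_diff_right)
    then show ?thesis
      using psd unfolding psd_def by metis
  qed
  then show ?thesis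
    using assms by (simp add: psd_def transpose_diff matrix_transpose_mul matrix_mul_assoc)
qed

text \<open>The block matrix is the congruence of \<open>S\<close> by the stacked matrix of \<open>K\<close> and the identity.\<close>
lemma psd_block_feedback:
  fixes K :: "real^'x^'u"
  assumes "psd S"
  shows "psd (block_matrix (K ** S ** transpose K) (K ** S) (transpose (K ** S)) S)"
    (is "psd ?M")
proof -
  have "0 \<le> z \<bullet> (?M *v z)" for z
  proof -
    define x y where "x = (\<chi> a. z $ Inl a)" and "y = (\<chi> b. z $ Inr b)"
    have "z \<bullet> (?M *v z) = (x v* K + y) \<bullet> (S *v (x v* K + y))"
      unfolding block_quadratic_form
      by (simp add: matrix_vector_right_distrib inner_add_left inner_add_right dot_lmul_matrix
          matrix_transpose_mul psd_symmetric[OF assms] flip: matrix_vector_mul_assoc x_def y_def)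
    then show ?thesis
      using assms by (simp add: psd_def)
  qed
  moreover have "transpose ?M = ?M"
    using psd_symmetric[OF assms] psd_symmetric[OF psd_congruence[OF assms, of K]]
    by (simp add: transpose_block_matrix)
  ultimately show ?thesis
    by (simp add: psd_def)
qed

section \<open>The closed loop\<close>

lemma matrix_power_Suc: "matrix_power M (Suc k) = matrix_power M k ** M"
proof -
  have "((**) M ^^ Suc k) N = ((**) M ^^ k) (mat 1) ** M ** N" for N
    by (induction k arbitrary: N) (simp_all add: matrix_mul_assoc)
  from this[of "mat 1"] show ?thesis
    by (simp add: matrix_power_def)
qed

lemma rho_Suc: "rho D (Suc k) j = (\<Sum>i\<in>UNIV. trans D $ i $ j * rho D k i)"
  unfolding rho_def matrix_power_Suc vector_matrix_mul_assoc[symmetric]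
  by (simp add: vector_matrix_mult_def mult.commute)

text \<open>When \<open>s\<close> is the total weight and \<open>x\<close> the weighted mean of the \<open>m i\<close>, the difference is the weighted
  covariance matrix, that is, the weighted sum of the outer products of \<open>m i - x\<close>.\<close>
lemma psd_weighted_outer_diff:
  fixes m :: "'i::finite \<Rightarrow> real^'n" and x :: "real^'n"
  assumes w: "\<And>i. 0 \<le> w i" and s: "s = (\<Sum>i\<in>UNIV. w i)"
    and mean: "s *\<^sub>R x = (\<Sum>i\<in>UNIV. w i *\<^sub>R m i)"
  shows "psd ((\<Sum>i\<in>UNIV. w i *\<^sub>R outer (m i)) - s *\<^sub>R outer x)"
proof -
  have mean': "(\<Sum>i\<in>UNIV. w i * m i $ a) = s * x $ a" for a
    using mean by (simp add: vec_eq_iff)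
  have "(\<Sum>i\<in>UNIV. w i * ((m i $ a - x $ a) * (m i $ b - x $ b)))
      = (\<Sum>i\<in>UNIV. w i * (m i $ a * m i $ b)) - s * (x $ a * x $ b)" (is "?lhs = _") for a b
  proof -
    have "?lhs = (\<Sum>i\<in>UNIV. w i * (m i $ a * m i $ b)) - (\<Sum>i\<in>UNIV. w i * m i $ a) * x $ b
        - (\<Sum>i\<in>UNIV. w i * m i $ b) * x $ a + (\<Sum>i\<in>UNIV. w i) * (x $ a * x $ b)"
      by (simp add: sum_distrib_right flip: sum_subtractf sum.distrib)
        (simp add: algebra_simps)
    then show ?thesis
      unfolding mean' s[symmetric] by (simp add: algebra_simps)
  qed
  then have "(\<Sum>i\<in>UNIV. w i *\<^sub>R outer (m i)) - s *\<^sub>R outer x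
      = (\<Sum>i\<in>UNIV. w i *\<^sub>R outer (m i - x))"
    by (simp add: vec_eq_iff outer_nth)
  then show ?thesis
    using w by (simp add: psd_sum psd_scaleR psd_outer)
qed

text \<open>The right-hand side of the covariance recursion, kept as a function of arbitrary \<open>S\<close>, \<open>L\<close>, \<open>Y\<close> so
  that it can be rerun with another control policy.\<close>
definition propagate ::
  "('m::finite, 'x::finite, 'u::finite, 'w::finite) mjls \<Rightarrow> ('m, 'x, 'u) trajectory \<Rightarrow> nat \<Rightarrow>
   ('m \<Rightarrow> real^'x^'x) \<Rightarrow> ('m \<Rightarrow> real^'x^'u) \<Rightarrow> ('m \<Rightarrow> real^'u^'u) \<Rightarrow> 'm \<Rightarrow> real^'x^'x" where
  "propagate D \<tau> k S L Y j =
     (\<Sum>i\<in>UNIV. trans D $ i $ j *\<^sub>R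
        (Amat D k i ** S i ** transpose (Amat D k i)
         + Amat D k i ** transpose (L i) ** transpose (Bmat D k i)
         + Bmat D k i ** L i ** transpose (Amat D k i)
         + Bmat D k i ** Y i ** transpose (Bmat D k i)
         + rho D k i *\<^sub>R outer (mvec D \<tau> k i)
         + rho D k i *\<^sub>R (Gmat D k i ** transpose (Gmat D k i))))
     - rho D (Suc k) j *\<^sub>R outer (xbar \<tau> (Suc k) j)"

definition disturbance ::
  "('m::finite, 'x::finite, 'u::finite, 'w::finite) mjls \<Rightarrow> ('m, 'x, 'u) trajectory \<Rightarrow> nat \<Rightarrow>
   'm \<Rightarrow> real^'x^'x" where
  "disturbance D \<tau> k j =
     (\<Sum>i\<in>UNIV. trans D $ i $ j *\<^sub>R (rho D k i *\<^sub>R outer (mvec D \<tau> k i)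
        + rho D k i *\<^sub>R (Gmat D k i ** transpose (Gmat D k i))))
     - rho D (Suc k) j *\<^sub>R outer (xbar \<tau> (Suc k) j)"

lemma psd_disturbance:
  assumes data: "mjls_data D" and traj: "mean_trajectory D \<tau>" and k: "k < horizon D"
    and rho: "\<And>i. 0 \<le> rho D k i"
  shows "psd (disturbance D \<tau> k j)"
proof -
  have p: "0 \<le> trans D $ i $ j" for i
    using data by (simp add: mjls_data_def)
  have "rho D (Suc k) j *\<^sub>R xbar \<tau> (Suc k) j
      = (\<Sum>i\<in>UNIV. (trans D $ i $ j * rho D k i) *\<^sub>R mvec D \<tau> k i)"
    using traj k
    by (simp add: mean_trajectory_def Let_def mvec_def matrix_vector_mult_scaleR scaleR_add_right
        add.assoc)
  then have "psd ((\<Sum>i\<in>UNIV. (trans D $ i $ j * rho D k i) *\<^sub>R outer (mvec D \<tau> k i))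
      - rho D (Suc k) j *\<^sub>R outer (xbar \<tau> (Suc k) j))"
    using p rho by (intro psd_weighted_outer_diff) (simp_all add: rho_Suc)
  moreover have "psd (\<Sum>i\<in>UNIV. (trans D $ i $ j * rho D k i) *\<^sub>R
      (Gmat D k i ** transpose (Gmat D k i)))"
    using p rho by (intro psd_sum psd_scaleR psd_gram) simp
  ultimately show ?thesis
    using psd_add by (fastforce simp: disturbance_def scaleR_add_right sum.distrib algebra_simps)
qed

text \<open>Completing the square: for \<open>L = K S\<close> the cross terms and \<open>B K S K\<^sup>T B\<^sup>T\<close> combine with \<open>A S A\<^sup>T\<close> to a
  congruence of \<open>S\<close>, so that the right-hand side becomes monotone in \<open>S\<close> and in the slack
  \<open>Y - K S K\<^sup>T\<close>.\<close>
lemma propagate_feedback: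
  fixes K :: "'m::finite \<Rightarrow> real^'x^'u" and D :: "('m, 'x::finite, 'u::finite, 'w::finite) mjls"
    and k :: nat
  assumes S: "\<And>i. transpose (S i) = S i"
  defines "F \<equiv> \<lambda>i. Amat D k i + Bmat D k i ** K i"
  shows "propagate D \<tau> k S (\<lambda>i. K i ** S i) Y j =
    (\<Sum>i\<in>UNIV. trans D $ i $ j *\<^sub>R
       (F i ** S i ** transpose (F i)
        + Bmat D k i ** (Y i - K i ** S i ** transpose (K i)) ** transpose (Bmat D k i)))
    + disturbance D \<tau> k j"
proof -
  have "Amat D k i ** S i ** transpose (Amat D k i)
         + Amat D k i ** transpose (K i ** S i) ** transpose (Bmat D k i)
         + Bmat D k i ** (K i ** S i) ** transpose (Amat D k i)
         + Bmat D k i ** Y i ** transpose (Bmat D k i)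
      = F i ** S i ** transpose (F i)
        + Bmat D k i ** (Y i - K i ** S i ** transpose (K i)) ** transpose (Bmat D k i)" for i
    by (simp add: F_def S matrix_transpose_mul transpose_add matrix_add_ldistrib
        matrix_add_rdistrib matrix_diff_ldistrib matrix_diff_rdistrib matrix_mul_assoc)
  then show ?thesis
    unfolding propagate_def disturbance_def
    by (simp add: add.assoc sum.distrib scaleR_add_right)
qed

text \<open>The covariances under linear feedback with gains \<open>K\<close>, where every slack \<open>Y - K S K\<^sup>T\<close> is zero.\<close>
primrec feedback_cov ::
  "('m::finite, 'x::finite, 'u::finite, 'w::finite) mjls \<Rightarrow> ('m, 'x, 'u) trajectory \<Rightarrow>
   (nat \<Rightarrow> 'm \<Rightarrow> real^'x^'u) \<Rightarrow> nat \<Rightarrow> 'm \<Rightarrow> real^'x^'x" where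
  "feedback_cov D \<tau> K 0 = (\<lambda>i. rho D 0 i *\<^sub>R Sigma0 D)"
| "feedback_cov D \<tau> K (Suc k) =
     propagate D \<tau> k (feedback_cov D \<tau> K k) (\<lambda>i. K k i ** feedback_cov D \<tau> K k i)
       (\<lambda>i. K k i ** feedback_cov D \<tau> K k i ** transpose (K k i))"

definition feedback_decision ::
  "('m::finite, 'x::finite, 'u::finite, 'w::finite) mjls \<Rightarrow> ('m, 'x, 'u) trajectory \<Rightarrow>
   (nat \<Rightarrow> 'm \<Rightarrow> real^'x^'u) \<Rightarrow> ('m, 'x, 'u) decision" where
  "feedback_decision D \<tau> K =
     \<lparr>Svar = feedback_cov D \<tau> K,
      Lvar = (\<lambda>k i. K k i ** feedback_cov D \<tau> K k i),
      Yvar = (\<lambda>k i. K k i ** feedback_cov D \<tau> K k i ** transpose (K k i))\<rparr>"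

text \<open>With the gains of \<open>\<Xi>\<close> kept and the slack removed, the covariances can only shrink: both
  recursions have the form of \<open>propagate_feedback\<close> with the same disturbance, and the one for \<open>\<Xi>\<close> has
  the slack as an additional nonnegative input. Smaller covariances preserve the terminal constraint.\<close>
lemma feedback_decision_dominated:
  fixes D :: "('m::finite, 'x::finite, 'u::finite, 'w::finite) mjls"
  assumes data: "mjls_data D" and traj: "mean_trajectory D \<tau>"
    and rho: "\<And>k i. k \<le> horizon D \<Longrightarrow> 0 \<le> rho D k i"
    and feas: "feasible D \<tau> \<Xi>"
    and S0: "\<And>i. psd (Svar \<Xi> 0 i)"
    and gain: "\<And>k i. k < horizon D \<Longrightarrow> Lvar \<Xi> k i = K k i ** Svar \<Xi> k i"
  defines "S' \<equiv> feedback_cov D \<tau> K"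
  shows "feasible D \<tau> (feedback_decision D \<tau> K)"
    and "k \<le> horizon D \<Longrightarrow> psd (Svar \<Xi> k i - S' k i)"
    and "k < horizon D \<Longrightarrow> psd (Yvar \<Xi> k i - K k i ** Svar \<Xi> k i ** transpose (K k i))"
proof -
  have eqs: "equality_constraints D \<tau> \<Xi>"
    and lmi: "\<And>k i. k < horizon D \<Longrightarrow> psd (lmi_block \<Xi> k i)"
    and terminal: "psd (Sigmaf D - terminal_covariance D \<tau> \<Xi>)"
    using feas by (simp_all add: feasible_def)
  have symS: "transpose (Svar \<Xi> k i) = Svar \<Xi> k i" if "k \<le> horizon D" for k i
    using eqs that by (simp add: equality_constraints_def)
  have symY: "transpose (Yvar \<Xi> k i) = Yvar \<Xi> k i" if "k < horizon D" for k i
    using eqs that by (simp add: equality_constraints_def)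
  have p: "0 \<le> trans D $ i $ j" for i j
    using data by (simp add: mjls_data_def)
  have slack: "psd (Yvar \<Xi> k i - K k i ** Svar \<Xi> k i ** transpose (K k i))"
    if "k < horizon D" for k i
    using lmi[OF that, of i] symS[of k i] symY[of k i] that
    by (intro psd_block_imp_schur) (simp_all add: lmi_block_def gain)
  then show "k < horizon D \<Longrightarrow> psd (Yvar \<Xi> k i - K k i ** Svar \<Xi> k i ** transpose (K k i))" .
  have sandwich: "psd (S' k i) \<and> psd (Svar \<Xi> k i - S' k i)" if "k \<le> horizon D" for k i
    using that
  proof (induction k arbitrary: i)
    case 0
    have "S' 0 i = Svar \<Xi> 0 i"
      using eqs by (simp add: S'_def equality_constraints_def)
    then show ?case
      using S0 psd_0 by simp
  next
    case (Suc k)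
    then have k: "k < horizon D" and S': "psd (S' k i)" and le: "psd (Svar \<Xi> k i - S' k i)" for i
      by simp_all
    define F where "F = (\<lambda>i. Amat D k i + Bmat D k i ** K k i)"
    have S'_Suc: "S' (Suc k) j =
        (\<Sum>i\<in>UNIV. trans D $ i $ j *\<^sub>R (F i ** S' k i ** transpose (F i)))
        + disturbance D \<tau> k j" for j
      using propagate_feedback[of "S' k" D \<tau> k "K k"] psd_symmetric[OF S']
      by (simp add: S'_def F_def matrix_diff_ldistrib matrix_diff_rdistrib)
    have "Svar \<Xi> (Suc k) j = propagate D \<tau> k (Svar \<Xi> k) (\<lambda>i. K k i ** Svar \<Xi> k i) (Yvar \<Xi> k) j"
      for j
      using eqs k unfolding equality_constraints_def propagate_def gain[OF k, symmetric] by simp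
    then have S_Suc: "Svar \<Xi> (Suc k) j =
        (\<Sum>i\<in>UNIV. trans D $ i $ j *\<^sub>R (F i ** Svar \<Xi> k i ** transpose (F i)
          + Bmat D k i ** (Yvar \<Xi> k i - K k i ** Svar \<Xi> k i ** transpose (K k i))
              ** transpose (Bmat D k i)))
        + disturbance D \<tau> k j" for j
      using propagate_feedback[of "Svar \<Xi> k" D \<tau> k "K k" "Yvar \<Xi> k"] symS k by (simp add: F_def)
    have diff: "Svar \<Xi> (Suc k) j - S' (Suc k) j =
        (\<Sum>i\<in>UNIV. trans D $ i $ j *\<^sub>R (F i ** (Svar \<Xi> k i - S' k i) ** transpose (F i)
          + Bmat D k i ** (Yvar \<Xi> k i - K k i ** Svar \<Xi> k i ** transpose (K k i))
              ** transpose (Bmat D k i)))" for j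
      unfolding S_Suc S'_Suc
      by (simp add: matrix_diff_ldistrib[of "F _"] matrix_diff_rdistrib[of _ _ "transpose (F _)"]
          scaleR_add_right scaleR_diff_right sum.distrib sum_subtractf)
    have "psd (Svar \<Xi> (Suc k) i - S' (Suc k) i)"
      unfolding diff
      using p slack[OF k] le by (intro psd_sum psd_scaleR psd_add psd_congruence)
    moreover have "psd (S' (Suc k) i)"
      unfolding S'_Suc
      using p S' psd_disturbance[OF data traj k] rho[of k] k
      by (intro psd_add psd_sum psd_scaleR psd_congruence) simp_all
    ultimately show ?case
      by simp
  qed
  then show "k \<le> horizon D \<Longrightarrow> psd (Svar \<Xi> k i - S' k i)"
    by blast
  let ?\<Xi>' = "feedback_decision D \<tau> K"
  have S': "psd (S' k i)" if "k \<le> horizon D" for k i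
    using sandwich that by blast
  have "transpose (K k i ** S' k i ** transpose (K k i)) = K k i ** S' k i ** transpose (K k i)"
    if "k < horizon D" for k i
    using that by (intro psd_symmetric psd_congruence S') simp
  then have "equality_constraints D \<tau> ?\<Xi>'"
    using psd_symmetric[OF S']
    by (simp add: equality_constraints_def feedback_decision_def S'_def propagate_def[abs_def])
  moreover have "psd (lmi_block ?\<Xi>' k i)" if "k < horizon D" for k i
    using that S' by (simp add: lmi_block_def feedback_decision_def psd_block_feedback S'_def)
  moreover have "psd (Sigmaf D - terminal_covariance D \<tau> ?\<Xi>')"
  proof -
    have "psd (\<Sum>i\<in>UNIV. Svar \<Xi> (horizon D) i - S' (horizon D) i)"
      using sandwich by (intro psd_sum) simp
    also have "(\<Sum>i\<in>UNIV. Svar \<Xi> (horizon D) i - S' (horizon D) i)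
        = terminal_covariance D \<tau> \<Xi> - terminal_covariance D \<tau> ?\<Xi>'"
      by (simp add: terminal_covariance_def Let_def feedback_decision_def S'_def
          sum.distrib sum_subtractf)
    finally show ?thesis
      using terminal psd_diff_trans by blast
  qed
  ultimately show "feasible D \<tau> ?\<Xi>'"
    by (simp add: feasible_def)
qed

text \<open>The cost difference is a sum of traces of products of positive semidefinite matrices, so it can
  only be nonpositive if every summand vanishes.\<close>
lemma cost_le_imp_Yvar_eq:
  fixes D :: "('m::finite, 'x::finite, 'u::finite, 'w::finite) mjls"
  assumes data: "mjls_data D" and le: "cost D \<Xi> \<le> cost D \<Xi>'"
    and S: "\<And>k i. k < horizon D \<Longrightarrow> psd (Svar \<Xi> k i - Svar \<Xi>' k i)"
    and Y: "\<And>k i. k < horizon D \<Longrightarrow> psd (Yvar \<Xi> k i - Yvar \<Xi>' k i)"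
    and k: "k < horizon D"
  shows "Yvar \<Xi> k i = Yvar \<Xi>' k i"
proof -
  define c where "c = (\<lambda>k i. trace ((Svar \<Xi> k i - Svar \<Xi>' k i) ** Qcost D k)
    + trace ((Yvar \<Xi> k i - Yvar \<Xi>' k i) ** Rcost D k))"
  have Q: "psd (Qcost D k)" and R: "pd (Rcost D k)" if "k < horizon D" for k
    using data that by (simp_all add: mjls_data_def)
  have trQ: "0 \<le> trace ((Svar \<Xi> k i - Svar \<Xi>' k i) ** Qcost D k)" if "k < horizon D" for k i
    using that S Q by (simp add: trace_psd_mult_nonneg)
  have trR: "0 \<le> trace ((Yvar \<Xi> k i - Yvar \<Xi>' k i) ** Rcost D k)" if "k < horizon D" for k i
    using that Y R by (simp add: trace_psd_mult_nonneg pd_imp_psd)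
  have c0: "0 \<le> c k i" if "k < horizon D" for k i
    using trQ[OF that] trR[OF that] by (simp add: c_def)
  have "(\<Sum>k<horizon D. \<Sum>i\<in>UNIV. c k i) = cost D \<Xi> - cost D \<Xi>'"
    by (simp add: c_def cost_def matrix_diff_rdistrib trace_sub sum.distrib sum_subtractf)
  moreover have "0 \<le> (\<Sum>k<horizon D. \<Sum>i\<in>UNIV. c k i)"
    using c0 by (intro sum_nonneg) simp_all
  ultimately have "(\<Sum>k<horizon D. \<Sum>i\<in>UNIV. c k i) = 0"
    using le by simp
  then have "(\<Sum>i\<in>UNIV. c k i) = 0"
    using c0 k by (subst (asm) sum_nonneg_eq_0_iff) (auto intro: sum_nonneg)
  then have "c k i = 0"
    using c0[OF k] by (subst (asm) sum_nonneg_eq_0_iff) auto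
  then have "trace ((Yvar \<Xi> k i - Yvar \<Xi>' k i) ** Rcost D k) = 0"
    using trQ[OF k, of i] trR[OF k, of i] by (simp add: c_def)
  then have "Yvar \<Xi> k i - Yvar \<Xi>' k i = 0"
    using trace_psd_mult_pd_eq_0_imp[OF Y[OF k] R[OF k]] by blast
  then show ?thesis
    by simp
qed

theorem theorem1:
  fixes D :: "('m::finite, 'x::finite, 'u::finite, 'w::finite) mjls"
    and \<tau> :: "('m, 'x, 'u) trajectory"
    and \<Xi> :: "('m, 'x, 'u) decision"
  assumes "mjls_data D"
    and "mean_trajectory D \<tau>"
    and "\<forall>k\<le>horizon D. \<forall>i. 0 < rho D k i"
    and "\<exists>\<Xi>'. strictly_feasible D \<tau> \<Xi>'"
    and "optimal D \<tau> \<Xi>"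
    and "\<forall>k\<le>horizon D. \<forall>i. pd (Svar \<Xi> k i)"
  shows "\<forall>k<horizon D. \<forall>i.
    Yvar \<Xi> k i = Lvar \<Xi> k i ** matrix_inv (Svar \<Xi> k i) ** transpose (Lvar \<Xi> k i)"
proof (intro allI impI)
  fix k i
  assume k: "k < horizon D"
  define K where "K = (\<lambda>k i. Lvar \<Xi> k i ** matrix_inv (Svar \<Xi> k i))"
  let ?\<Xi>' = "feedback_decision D \<tau> K"
  have S: "pd (Svar \<Xi> k i)" if "k \<le> horizon D" for k i
    using assms(6) that by blast
  have inv: "invertible (Svar \<Xi> k i)" if "k \<le> horizon D" for k i
    using S[OF that] by (rule pd_imp_invertible)
  have gain: "Lvar \<Xi> k i = K k i ** Svar \<Xi> k i" if "k < horizon D" for k i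
    using matrix_inv_inverse(2)[OF inv[of k i]] that
    by (simp add: K_def flip: matrix_mul_assoc)
  have feas: "feasible D \<tau> \<Xi>" and opt: "\<And>\<Xi>'. feasible D \<tau> \<Xi>' \<Longrightarrow> cost D \<Xi> \<le> cost D \<Xi>'"
    using assms(5) by (auto simp: optimal_def)
  have rho: "0 \<le> rho D k i" if "k \<le> horizon D" for k i
    using assms(3) that by (simp add: less_imp_le)
  have S0: "psd (Svar \<Xi> 0 i)" for i
    using S by (simp add: pd_imp_psd)
  have feas': "feasible D \<tau> ?\<Xi>'"
    by (rule feedback_decision_dominated(1)[OF assms(1,2) rho feas S0 gain])
  have S_le: "psd (Svar \<Xi> k i - Svar ?\<Xi>' k i)" if "k < horizon D" for k i
    using feedback_decision_dominated(2)[OF assms(1,2) rho feas S0 gain, of k i] that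
    by (simp add: feedback_decision_def)
  have slack: "psd (Yvar \<Xi> k i - K k i ** Svar \<Xi> k i ** transpose (K k i))" if "k < horizon D"
    for k i
    by (rule feedback_decision_dominated(3)[OF assms(1,2) rho feas S0 gain, OF _ _ that])
  have KSK: "psd (K k i ** Svar \<Xi> k i ** transpose (K k i) - Yvar ?\<Xi>' k i)" if "k < horizon D"
    for k i
    using psd_congruence[OF S_le[OF that, of i], of "K k i"]
    by (simp add: feedback_decision_def matrix_diff_ldistrib matrix_diff_rdistrib)
  have "Yvar \<Xi> k i = Yvar ?\<Xi>' k i"
    using psd_diff_trans[OF slack KSK]
    by (intro cost_le_imp_Yvar_eq[OF assms(1) opt[OF feas'] S_le _ k])
  \<comment> \<open>As \<open>Y = Y'\<close>, the bound \<open>Y' \<preceq> K S K\<^sup>T\<close> now opposes \<open>K S K\<^sup>T \<preceq> Y\<close>.\<close>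
  then have "psd (- (Yvar \<Xi> k i - K k i ** Svar \<Xi> k i ** transpose (K k i)))"
    using KSK[OF k, of i] by simp
  then have "Yvar \<Xi> k i = K k i ** Svar \<Xi> k i ** transpose (K k i)"
    using psd_antisym[OF slack[OF k]] by fastforce
  also have "\<dots> = Lvar \<Xi> k i ** matrix_inv (Svar \<Xi> k i) ** transpose (Lvar \<Xi> k i)"
    using gain[OF k, of i] matrix_inv_symmetric[OF inv pd_symmetric[OF S], of k i] k
    by (simp add: K_def matrix_transpose_mul matrix_mul_assoc)
  finally show "Yvar \<Xi> k i = Lvar \<Xi> k i ** matrix_inv (Svar \<Xi> k i) ** transpose (Lvar \<Xi> k i)" .
qed

end
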